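(* Let $\mathcal{H}$ be a complex Hilbert space and let $B\in\mathcal{B}(\mathcal{H})$ have $0$ as an isolated eigenvalue (isolated in $\sigma(B)$) at which the quasi-nilpotent part of $B$ vanishes. Let $P$ be the Riesz projector of $B$ at $0\in\sigma(B)$ and let $Q=\mathrm{Id}-P$. Let $A:\mathcal{D}(A)\to\mathcal{H}$ be a closed operator, put $\mathcal{D}:=\mathcal{D}(A)\cap P\mathcal{H}$, and assume that the compression $PA:\mathcal{D}\to P\mathcal{H}$ is densely defined on $P\mathcal{H}$ and closed, and that there exists $z\in\rho(A)\cap\rho(PA)$. Let $\mathcal{D}^{\intercal}$ be the orthogonal complement of $\mathcal{D}$ in $\mathcal{D}(A)$ with respect to the graph inner product of $A$. Assume further that $QA$ (defined on $\mathcal{D}(A)$) and $A\restriction_{\mathcal{D}^{\intercal}}$ extend to bounded operators on the closures (in $\mathcal{H}$) of their domains. Finally assume that $Q:\overline{\mathcal{D}^{\intercal}}^{\|\cdot\|_{\mathcal{H}}}\to Q\mathcal{H}$ has a bounded inverse. Then for all sufficiently large $\beta>0$ the operator $A+\beta B-z$ is boundedly invertible, and there is a constant $C$ independent of $\beta$ such that for all sufficiently large $\beta$ $$\left\|(A+\beta B-z)^{-1}-P(PA-z)^{-1}P\right\|\le \frac{C}{\beta}\xrightarrow{\beta\to\infty}0 .$$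
   Context: The operator $A+\beta B$ has domain $\mathcal{D}(A)$. For an isolated point $0\in\sigma(B)$ the Riesz projector (in general not orthogonal) is $P=\frac{1}{2\pi i}\oint_\Gamma (w-B)^{-1}\,dw$, with $\Gamma$ a positively oriented closed contour in $\rho(B)$ encircling $0$ and no other point of $\sigma(B)$. The quasi-nilpotent part of $B$ at zero vanishes means $PB=0$ (equivalently $BP=0$). Since $A$ is closed, $\mathcal{D}(A)$ with the graph inner product is a Hilbert space in which $\mathcal{D}$ is a closed subspace, so $\mathcal{D}(A)=\mathcal{D}\oplus\mathcal{D}^{\intercal}$. The resolvent set $\rho(PA)$ and the resolvent $(PA-z)^{-1}$ refer to the operator $PA:\mathcal{D}\to P\mathcal{H}$ on the space $P\mathcal{H}$. $\overline{\mathcal{D}^{\intercal}}^{\|\cdot\|_{\mathcal{H}}}$ denotes the closure of $\mathcal{D}^{\intercal}$ in the norm of $\mathcal{H}$. *)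

theory Defs
  imports "HOL-Complex_Analysis.Complex_Analysis"
begin

section \<open>Complex Hilbert spaces\<close>

text \<open>A complex Hilbert space is presented on top of its underlying real one: the real inner
  product, hence also the norm and the topology, is the real part of the complex inner product.
  The latter is antilinear in the first argument and linear in the second.\<close>

class chilbert_space = real_inner + complete_space +
  fixes scaleC :: "complex \<Rightarrow> 'a \<Rightarrow> 'a" (infixr \<open>*\<^sub>C\<close> 75)
    and cinner :: "'a \<Rightarrow> 'a \<Rightarrow> complex"
  assumes scaleC_add_right: "c *\<^sub>C (x + y) = c *\<^sub>C x + c *\<^sub>C y"
    and scaleC_add_left: "(c + d) *\<^sub>C x = c *\<^sub>C x + d *\<^sub>C x"
    and scaleC_scaleC: "c *\<^sub>C (d *\<^sub>C x) = (c * d) *\<^sub>C x"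
    and scaleC_of_real: "complex_of_real r *\<^sub>C x = r *\<^sub>R x"
    and cinner_commute: "cinner y x = cnj (cinner x y)"
    and cinner_add_right: "cinner x (y + z) = cinner x y + cinner x z"
    and cinner_scaleC_right: "cinner x (c *\<^sub>C y) = c * cinner x y"
    and Re_cinner: "Re (cinner x y) = x \<bullet> y"

instantiation complex :: chilbert_space
begin

definition scaleC_complex :: "complex \<Rightarrow> complex \<Rightarrow> complex"
  where "scaleC_complex c x = c * x"

definition cinner_complex :: "complex \<Rightarrow> complex \<Rightarrow> complex"
  where "cinner_complex x y = cnj x * y"

instance
  by standard
    (simp_all add: scaleC_complex_def cinner_complex_def algebra_simps scaleR_conv_of_real
      inner_complex_def)

end


section \<open>Operators\<close>

text \<open>An operator with domain \<open>D\<close> is a pair of a set \<open>D\<close> and a total function of which only the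
  values on \<open>D\<close> matter.\<close>

definition csubspace :: "'a::chilbert_space set \<Rightarrow> bool"
  where "csubspace S \<longleftrightarrow>
    0 \<in> S \<and> (\<forall>x\<in>S. \<forall>y\<in>S. x + y \<in> S) \<and> (\<forall>c. \<forall>x\<in>S. c *\<^sub>C x \<in> S)"

definition clinear_on ::
    "'a::chilbert_space set \<Rightarrow> ('a \<Rightarrow> 'b::chilbert_space) \<Rightarrow> bool"
  where "clinear_on D T \<longleftrightarrow> csubspace D \<and>
    (\<forall>x\<in>D. \<forall>y\<in>D. T (x + y) = T x + T y) \<and> (\<forall>c. \<forall>x\<in>D. T (c *\<^sub>C x) = c *\<^sub>C T x)"

definition bounded_clinear_on ::
    "'a::chilbert_space set \<Rightarrow> ('a \<Rightarrow> 'b::chilbert_space) \<Rightarrow> bool"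
  where "bounded_clinear_on D T \<longleftrightarrow>
    clinear_on D T \<and> (\<exists>K. \<forall>x\<in>D. norm (T x) \<le> K * norm x)"

abbreviation bounded_clinear :: "('a::chilbert_space \<Rightarrow> 'b::chilbert_space) \<Rightarrow> bool"
  where "bounded_clinear T \<equiv> bounded_clinear_on UNIV T"

definition closed_operator ::
    "'a::chilbert_space set \<Rightarrow> ('a \<Rightarrow> 'b::chilbert_space) \<Rightarrow> bool"
  where "closed_operator D T \<longleftrightarrow> clinear_on D T \<and> closed ((\<lambda>x. (x, T x)) ` D)"

definition densely_defined_on :: "'a::chilbert_space set \<Rightarrow> 'a set \<Rightarrow> bool"
  where "densely_defined_on M D \<longleftrightarrow> D \<subseteq> M \<and> M \<subseteq> closure D"

definition extends_boundedly ::
    "'a::chilbert_space set \<Rightarrow> ('a \<Rightarrow> 'b::chilbert_space) \<Rightarrow> bool"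
  where "extends_boundedly D T \<longleftrightarrow>
    (\<exists>T'. (\<forall>x\<in>D. T' x = T x) \<and> bounded_clinear_on (closure D) T')"

definition boundedly_invertible ::
    "'a::chilbert_space set \<Rightarrow> 'b::chilbert_space set \<Rightarrow> ('a \<Rightarrow> 'b) \<Rightarrow> bool"
  where "boundedly_invertible D M T \<longleftrightarrow>
    bij_betw T D M \<and> bounded_clinear_on M (inv_into D T)"

text \<open>Resolvent set of an operator \<open>T\<close> with domain \<open>D \<subseteq> M\<close> on the Hilbert space \<open>M\<close>, and its
  resolvent, with the sign convention \<open>(T - z)\<^sup>-\<^sup>1\<close>.\<close>

definition resolvent_set ::
    "'a::chilbert_space set \<Rightarrow> 'a set \<Rightarrow> ('a \<Rightarrow> 'a) \<Rightarrow> complex set"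
  where "resolvent_set D M T = {z. boundedly_invertible D M (\<lambda>x. T x - z *\<^sub>C x)}"

definition resolvent ::
    "'a::chilbert_space set \<Rightarrow> ('a \<Rightarrow> 'a) \<Rightarrow> complex \<Rightarrow> 'a \<Rightarrow> 'a"
  where "resolvent D T z = inv_into D (\<lambda>x. T x - z *\<^sub>C x)"

definition spectrum :: "('a::chilbert_space \<Rightarrow> 'a) \<Rightarrow> complex set"
  where "spectrum B = - resolvent_set UNIV UNIV B"

definition isolated_eigenvalue :: "('a::chilbert_space \<Rightarrow> 'a) \<Rightarrow> complex \<Rightarrow> bool"
  where "isolated_eigenvalue B a \<longleftrightarrow>
    (\<exists>x. x \<noteq> 0 \<and> B x = a *\<^sub>C x) \<and> a isolated_in spectrum B"


section \<open>Riesz projectors\<close>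


definition riesz_contour ::
    "('a::chilbert_space \<Rightarrow> 'a) \<Rightarrow> complex \<Rightarrow> (real \<Rightarrow> complex) \<Rightarrow> bool"
  where "riesz_contour B a \<Gamma> \<longleftrightarrow>
    valid_path \<Gamma> \<and> pathfinish \<Gamma> = pathstart \<Gamma> \<and>
    path_image \<Gamma> \<subseteq> resolvent_set UNIV UNIV B \<and>
    winding_number \<Gamma> a = 1 \<and> (\<forall>w \<in> spectrum B - {a}. winding_number \<Gamma> w = 0)"

text \<open>The vector-valued analogue of \<^const>\<open>contour_integral\<close>.\<close>

definition contour_integral_vec ::
    "(real \<Rightarrow> complex) \<Rightarrow> (complex \<Rightarrow> 'a::chilbert_space) \<Rightarrow> 'a"
  where "contour_integral_vec \<Gamma> f =
    integral {0..1} (\<lambda>t. vector_derivative \<Gamma> (at t within {0..1}) *\<^sub>C f (\<Gamma> t))"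

text \<open>The operator-valued integral of \<open>(w - B)\<^sup>-\<^sup>1\<close> is taken pointwise. Along a contour in the
  resolvent set the integrand is (piecewise) norm-continuous, so that this is also the integral in
  operator norm.\<close>

definition riesz_projector ::
    "('a::chilbert_space \<Rightarrow> 'a) \<Rightarrow> (real \<Rightarrow> complex) \<Rightarrow> 'a \<Rightarrow> 'a"
  where "riesz_projector B \<Gamma> x =
    (1 / (2 * of_real pi * \<i>)) *\<^sub>C contour_integral_vec \<Gamma> (\<lambda>w. inv (\<lambda>y. w *\<^sub>C y - B y) x)"


section \<open>The graph inner product\<close>

definition graph_cinner ::
    "('a::chilbert_space \<Rightarrow> 'b::chilbert_space) \<Rightarrow> 'a \<Rightarrow> 'a \<Rightarrow> complex"
  where "graph_cinner A x y = cinner x y + cinner (A x) (A y)"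

definition graph_orthogonal_complement ::
    "'a::chilbert_space set \<Rightarrow> ('a \<Rightarrow> 'b::chilbert_space) \<Rightarrow> 'a set \<Rightarrow> 'a set"
  where "graph_orthogonal_complement DA A D = {x \<in> DA. \<forall>y\<in>D. graph_cinner A x y = 0}"

end

theory Submission
  imports Defs
begin

text \<open>
The spectral part of the argument reduces to one operator. On the contour \<open>\<Gamma>\<close> the identity
\<open>(w - B)\<^sup>-\<^sup>1 x = w\<^sup>-\<^sup>1 x + w\<^sup>-\<^sup>1 (w - B)\<^sup>-\<^sup>1 B x\<close> holds, and \<open>\<Gamma>\<close> winds once around \<open>0\<close>. Integrating it
shows that \<open>S = - (1 / 2\<pi>\<i>) \<integral> w\<^sup>-\<^sup>1 (w - B)\<^sup>-\<^sup>1 dw\<close> satisfies \<open>S B = B S = Id - P = Q\<close>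
(\<open>riesz_projector_reduced_inverse\<close>). Together with \<open>P B = 0\<close> this already gives everything that is
needed about \<open>P\<close>: the projector is bounded, \<open>P - P\<^sup>2 = P B S = 0\<close>, and \<open>B P = B - B S B = P B = 0\<close>.

The integral is a gauge integral along a path that may have infinite length, so that
the boundedness of the resolvent on \<open>\<Gamma>\<close> does not by itself make it exist. It exists because the integrand has
local primitives, given by power series (\<open>divided_resolvent_local_primitive\<close>). Hence the integral is
a finite sum of increments of such primitives, and each increment is bounded in terms of \<open>\<parallel>x\<parallel>\<close>
(\<open>contour_integral_vec_bounded\<close>).

For the limit of strong coupling, closedness of \<open>A\<close> and boundedness of \<open>A\<close> on \<open>\<D>\<^sup>\<top>\<close> imply
that \<open>V = closure \<D>\<^sup>\<top>\<close> lies in the domain of \<open>A\<close> and that \<open>A\<close> is bounded on it. Let \<open>J : Q\<H> \<rightarrow> V\<close> be the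
inverse of \<open>Q\<close> on \<open>V\<close>. Each \<open>x\<close> in the domain of \<open>A\<close> splits as \<open>x = J w + u\<close> with \<open>w = Q x\<close> and
\<open>u \<in> \<D>\<close>. Put \<open>E = (A - z) J\<close> and \<open>R = (P A - z)\<^sup>-\<^sup>1 P\<close>. Applying \<open>P\<close> and \<open>S Q\<close> to
\<open>(A + \<beta> B - z) x = y\<close> turns that equation into
\<open>u = R (y - E w)\<close> and \<open>\<beta> w = G (y - E w)\<close>, where \<open>G = S (Q - Q A R)\<close> and \<open>E\<close> are bounded.
For large \<open>\<beta>\<close> the second equation is a contraction problem for \<open>w\<close>; it has a unique solution and
\<open>\<parallel>w\<parallel> \<le> C' \<parallel>y\<parallel> / \<beta>\<close>. Then \<open>x - R y = (J - R E) w\<close> is of the same order, and \<open>R = P (P A - z)\<^sup>-\<^sup>1 P\<close>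
is the claimed limit of the resolvents (\<open>strong_coupling_estimate\<close>).
\<close>

section \<open>Complex scalars and bounded operators\<close>

instance chilbert_space \<subseteq> banach ..

lemma scaleC_one: "1 *\<^sub>C x = (x::'a::chilbert_space)"
  using scaleC_of_real[of 1 x] by simp

text \<open>The norm comes from the real inner product, which is the real part of the complex one; so complex
homogeneity has to be derived from sesquilinearity.\<close>

lemma norm_scaleC: "norm (c *\<^sub>C x) = cmod c * norm (x::'a::chilbert_space)"
proof -
  have "cinner (c *\<^sub>C x) (c *\<^sub>C x) = c * cnj (cinner x (c *\<^sub>C x))"
    by (metis cinner_commute cinner_scaleC_right)
  also have "\<dots> = (c * cnj c) * cinner x x"
    by (metis cinner_commute cinner_scaleC_right complex_cnj_mult mult.assoc)
  also have "c * cnj c = of_real ((cmod c)\<^sup>2)"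
    using complex_norm_square[of c] by simp
  finally have "Re (cinner (c *\<^sub>C x) (c *\<^sub>C x)) = (cmod c)\<^sup>2 * Re (cinner x x)"
    by simp
  then have "(norm (c *\<^sub>C x))\<^sup>2 = (cmod c * norm x)\<^sup>2"
    by (simp add: Re_cinner power2_norm_eq_inner power_mult_distrib)
  then show ?thesis
    by (simp add: power2_eq_iff_nonneg)
qed

lemma bounded_bilinear_scaleC:
  "bounded_bilinear (scaleC :: complex \<Rightarrow> 'a \<Rightarrow> 'a::chilbert_space)"
proof
  fix r :: real and c :: complex and x :: 'a
  show "(r *\<^sub>R c) *\<^sub>C x = r *\<^sub>R c *\<^sub>C x"
    by (metis scaleC_of_real scaleC_scaleC scaleR_conv_of_real)
  show "c *\<^sub>C r *\<^sub>R x = r *\<^sub>R c *\<^sub>C x"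
    by (metis mult.commute scaleC_of_real scaleC_scaleC)
  show "\<exists>K. \<forall>(a::complex) (b::'a). norm (a *\<^sub>C b) \<le> norm a * norm b * K"
    by (metis mult.right_neutral norm_scaleC order_refl)
qed (simp_all add: scaleC_add_left scaleC_add_right)

interpretation scaleC: bounded_bilinear "scaleC :: complex \<Rightarrow> 'a \<Rightarrow> 'a::chilbert_space"
  by (rule bounded_bilinear_scaleC)

lemmas scaleC_algebra = scaleC_add_left scaleC_add_right scaleC.diff_left scaleC.diff_right
  scaleC.minus_left scaleC.minus_right scaleC_scaleC

lemma bounded_clinear_imp_bounded_linear:
  assumes "bounded_clinear T"
  shows "bounded_linear T"
proof -
  obtain K where K: "\<And>x. norm (T x) \<le> K * norm x"
    using assms by (auto simp: bounded_clinear_on_def)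
  have lin: "T (x + y) = T x + T y" "T (c *\<^sub>C x) = c *\<^sub>C T x" for x y c
    using assms by (auto simp: bounded_clinear_on_def clinear_on_def)
  show ?thesis
    by (rule bounded_linear_intro[of _ K])
       (use K lin in \<open>auto simp: mult.commute simp flip: scaleC_of_real\<close>)
qed

lemma bounded_clinearI:
  assumes "bounded_linear T" "\<And>c x. T (c *\<^sub>C x) = c *\<^sub>C T x"
  shows "bounded_clinear T"
proof -
  obtain K where "\<And>x. norm (T x) \<le> norm x * K"
    using bounded_linear.bounded[OF assms(1)] by auto
  then show ?thesis
    using assms(2) linear_add[OF bounded_linear.linear[OF assms(1)]]
    by (auto simp: bounded_clinear_on_def clinear_on_def csubspace_def mult.commute)
qed

lemma bounded_linear_norm_le_pos:
  assumes "bounded_linear T"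
  obtains K where "K > 0" "\<And>x. norm (T x) \<le> K * norm x"
  using bounded_linear.pos_bounded[OF assms] by (auto simp: mult.commute)

lemma clinear_on_diff:
  assumes T: "clinear_on D T" and xy: "x \<in> D" "y \<in> D"
  shows "x - y \<in> D" "T (x - y) = T x - T y"
proof -
  have "(- 1) *\<^sub>C y \<in> D" "T ((- 1) *\<^sub>C y) = (- 1) *\<^sub>C T y"
    using T xy(2) unfolding clinear_on_def csubspace_def by blast+
  then have y: "- y \<in> D" "T (- y) = - T y"
    by (simp_all add: scaleC.minus_left scaleC_one)
  then have "x + - y \<in> D" "T (x + - y) = T x + - T y"
    using T xy(1) unfolding clinear_on_def csubspace_def by (blast, metis)
  then show "x - y \<in> D" "T (x - y) = T x - T y"
    by simp_all
qed

lemma bounded_clinear_compose_on: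
  assumes "bounded_clinear_on M g" "bounded_clinear f" "\<And>x. f x \<in> M"
  shows "bounded_clinear (\<lambda>x. g (f x))"
proof -
  obtain K where K: "\<And>x. x \<in> M \<Longrightarrow> norm (g x) \<le> K * norm x"
    using assms(1) by (auto simp: bounded_clinear_on_def)
  obtain L where L: "\<And>x. norm (f x) \<le> L * norm x"
    using assms(2) by (auto simp: bounded_clinear_on_def)
  have "norm (g (f x)) \<le> \<bar>K\<bar> * L * norm x" for x
  proof -
    have "norm (g (f x)) \<le> \<bar>K\<bar> * norm (f x)"
      using K[OF assms(3)[of x]] by (smt (verit) mult_right_mono norm_ge_zero)
    also have "\<dots> \<le> \<bar>K\<bar> * (L * norm x)"
      by (rule mult_left_mono[OF L]) simp
    finally show ?thesis by simp
  qed
  with assms show ?thesis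
    by (auto simp: bounded_clinear_on_def clinear_on_def csubspace_def)
qed

lemma bounded_clinear_sub:
  assumes "bounded_clinear f" "bounded_clinear g"
  shows "bounded_clinear (\<lambda>x. f x - g x)"
proof (rule bounded_clinearI)
  show "bounded_linear (\<lambda>x. f x - g x)"
    by (intro bounded_linear_sub bounded_clinear_imp_bounded_linear assms)
  show "f (c *\<^sub>C x) - g (c *\<^sub>C x) = c *\<^sub>C (f x - g x)" for c x
    using assms by (simp add: bounded_clinear_on_def clinear_on_def scaleC.diff_right)
qed

lemma bounded_clinear_scaleC:
  assumes "bounded_clinear f"
  shows "bounded_clinear (\<lambda>x. c *\<^sub>C f x)"
proof (rule bounded_clinearI)
  show "bounded_linear (\<lambda>x. c *\<^sub>C f x)"
    by (rule bounded_linear_compose[OF scaleC.bounded_linear_right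
        bounded_clinear_imp_bounded_linear[OF assms]])
  show "c *\<^sub>C f (d *\<^sub>C x) = d *\<^sub>C c *\<^sub>C f x" for d x
    using assms by (simp add: bounded_clinear_on_def clinear_on_def scaleC_scaleC mult.commute)
qed

text \<open>The a priori estimate yields injectivity as well as the bound on the inverse.\<close>

lemma boundedly_invertible_UNIV_I:
  assumes lin: "clinear_on D T" and surj: "\<And>y. \<exists>x\<in>D. T x = y"
    and le: "\<And>x. x \<in> D \<Longrightarrow> norm x \<le> K * norm (T x)"
  shows "boundedly_invertible D UNIV T"
proof -
  have "inj_on T D"
  proof (rule inj_onI)
    fix x y
    assume "x \<in> D" "y \<in> D" "T x = T y"
    then have "norm (x - y) \<le> 0"
      using le[of "x - y"] clinear_on_diff[OF lin, of x y] by simp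
    then show "x = y" by simp
  qed
  moreover have surj': "T ` D = UNIV"
    using surj by (metis UNIV_eq_I imageI)
  moreover have inv: "inv_into D T y \<in> D" "T (inv_into D T y) = y" for y
    using surj' by (simp_all add: inv_into_into f_inv_into_f)
  moreover have "inv_into D T (x + y) = inv_into D T x + inv_into D T y"
    "inv_into D T (c *\<^sub>C x) = c *\<^sub>C inv_into D T x" for x y c
    using lin inv \<open>inj_on T D\<close>
    by (auto intro!: inv_into_f_eq simp: clinear_on_def csubspace_def)
  moreover have "norm (inv_into D T y) \<le> K * norm y" for y
    using le[OF inv(1)[of y]] inv(2)[of y] by simp
  ultimately show ?thesis
    by (auto simp: boundedly_invertible_def bij_betw_def bounded_clinear_on_def clinear_on_def
        csubspace_def)
qed

text \<open>If \<open>v\<^sub>n \<rightarrow> v\<close> in \<open>V\<close>, then the bounded extension makes \<open>A v\<^sub>n\<close> converge, and the limit \<open>(v, A' v)\<close> stays in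
the closed graph.\<close>

lemma closure_subset_closed_operator_domain:
  assumes A: "closed_operator DA A" and "V \<subseteq> DA" and ext: "extends_boundedly V A"
  shows "closure V \<subseteq> DA" "bounded_clinear_on (closure V) A"
proof -
  obtain A' where eq: "\<And>x. x \<in> V \<Longrightarrow> A' x = A x" and A': "bounded_clinear_on (closure V) A'"
    using ext by (auto simp: extends_boundedly_def)
  obtain K where K: "\<And>x. x \<in> closure V \<Longrightarrow> norm (A' x) \<le> K * norm x"
    using A' by (auto simp: bounded_clinear_on_def)
  have lin: "clinear_on (closure V) A'"
    using A' by (simp add: bounded_clinear_on_def)
  have *: "v \<in> DA \<and> A v = A' v" if v: "v \<in> closure V" for v
  proof -
    obtain s where s: "\<And>n. s n \<in> V" "s \<longlonglongrightarrow> v"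
      using v by (auto simp: closure_sequential)
    have sc: "s n \<in> closure V" for n
      using s(1) closure_subset by blast
    have "(\<lambda>n. A' (s n) - A' v) \<longlonglongrightarrow> 0"
    proof (rule Lim_null_comparison)
      show "\<forall>\<^sub>F n in sequentially. norm (A' (s n) - A' v) \<le> K * norm (s n - v)"
        using K clinear_on_diff[OF lin sc v] by (metis (no_types, lifting) always_eventually)
      show "(\<lambda>n. K * norm (s n - v)) \<longlonglongrightarrow> 0"
        by (intro tendsto_mult_right_zero tendsto_norm_zero LIM_zero s)
    qed
    then have "(\<lambda>n. A' (s n)) \<longlonglongrightarrow> A' v"
      by (rule LIM_zero_cancel)
    then have "(\<lambda>n. (s n, A (s n))) \<longlonglongrightarrow> (v, A' v)"
      using s by (intro tendsto_Pair) (simp_all add: eq)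
    moreover have "closed ((\<lambda>x. (x, A x)) ` DA)"
      using A by (simp add: closed_operator_def)
    ultimately have "(v, A' v) \<in> (\<lambda>x. (x, A x)) ` DA"
      using s(1) \<open>V \<subseteq> DA\<close> by (intro closed_sequentially[of _ "\<lambda>n. (s n, A (s n))" "(v, A' v)"]) auto
    then show ?thesis by auto
  qed
  then show "closure V \<subseteq> DA" by blast
  show "bounded_clinear_on (closure V) A"
    using A' * by (auto simp: bounded_clinear_on_def clinear_on_def csubspace_def)
qed

section \<open>Vector-valued power series\<close>

text \<open>On the disc of half the guaranteed radius of convergence every series is dominated by a geometric
series of ratio \<open>1 / 2\<close>, with a constant proportional to \<open>C\<close>. This makes the estimates below linear in
\<open>C\<close>, which will be proportional to \<open>\<parallel>x\<parallel>\<close>.\<close>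

lemma power_series_majorant:
  fixes a :: "nat \<Rightarrow> 'a::chilbert_space"
  assumes "\<And>n. norm (a n) \<le> C * M ^ n" "M > 0" "cmod h < 1 / (2 * M)"
  shows "norm (h ^ n *\<^sub>C a n) \<le> C * (1/2) ^ n"
proof -
  have "C \<ge> 0"
    using assms(1)[of 0] norm_ge_zero[of "a 0"] by (metis mult.right_neutral order_trans power_0)
  have "norm (h ^ n *\<^sub>C a n) \<le> (1 / (2 * M)) ^ n * (C * M ^ n)"
    unfolding norm_scaleC norm_power
    by (intro mult_mono power_mono assms) (use assms in auto)
  also have "\<dots> = C * (1/2) ^ n"
    using assms(2) by (simp add: field_simps power_mult_distrib)
  finally show ?thesis .
qed

lemma power_series_summable:
  fixes a :: "nat \<Rightarrow> 'a::chilbert_space"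
  assumes "\<And>n. norm (a n) \<le> C * M ^ n" "M > 0" "cmod h < 1 / (2 * M)"
  shows "summable (\<lambda>n. h ^ n *\<^sub>C a n)"
  by (rule summable_comparison_test'[of "\<lambda>n. C * (1/2) ^ n"])
     (use power_series_majorant[of a, OF assms] in \<open>auto intro: summable_mult summable_geometric\<close>)

lemma power_series_norm_le:
  fixes a :: "nat \<Rightarrow> 'a::chilbert_space"
  assumes "\<And>n. norm (a n) \<le> C * M ^ n" "M > 0" "cmod h < 1 / (2 * M)"
  shows "norm (\<Sum>n. h ^ n *\<^sub>C a n) \<le> 2 * C"
proof -
  have "norm (\<Sum>n. h ^ n *\<^sub>C a n) \<le> (\<Sum>n. C * (1/2) ^ n)"
    by (rule norm_suminf_le)
       (use power_series_majorant[of a, OF assms] in \<open>auto intro: summable_mult summable_geometric\<close>)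
  also have "\<dots> = 2 * C"
    by (subst suminf_mult) (auto simp: suminf_geometric summable_geometric)
  finally show ?thesis .
qed

lemma power_series_split_head:
  fixes a :: "nat \<Rightarrow> 'a::chilbert_space"
  assumes "\<And>n. norm (a n) \<le> C * M ^ n" "M > 0" "cmod h < 1 / (2 * M)"
  shows "(\<Sum>n. h ^ n *\<^sub>C a n) = a 0 + h *\<^sub>C (\<Sum>n. h ^ n *\<^sub>C a (Suc n))"
proof -
  have "norm (a (Suc n)) \<le> C * M * M ^ n" for n
    using assms(1)[of "Suc n"] by (simp add: mult_ac)
  then have "summable (\<lambda>n. h ^ n *\<^sub>C a (Suc n))"
    by (rule power_series_summable[OF _ assms(2,3)])
  then have "h *\<^sub>C (\<Sum>n. h ^ n *\<^sub>C a (Suc n)) = (\<Sum>n. h *\<^sub>C (h ^ n *\<^sub>C a (Suc n)))"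
    by (rule bounded_linear.suminf[OF scaleC.bounded_linear_right])
  then show ?thesis
    using suminf_split_head[OF power_series_summable[of a, OF assms]]
    by (simp add: scaleC_scaleC scaleC_one algebra_simps)
qed

text \<open>The series may be integrated term by term, since it converges uniformly on the disc. The derivative is
taken in the real sense; it is the complex multiplication by the value of the series, which is
what the chain rule along a path requires.\<close>

lemma power_series_has_primitive:
  fixes a :: "nat \<Rightarrow> 'a::chilbert_space"
  assumes a: "\<And>n. norm (a n) \<le> C * M ^ n" and M: "M > 0"
  shows "\<exists>F. \<forall>w\<in>ball w0 (1 / (2 * M)).
    (F has_derivative (\<lambda>h. h *\<^sub>C (\<Sum>n. (w - w0) ^ n *\<^sub>C a n))) (at w)"
proof -
  define S where "S = ball w0 (1 / (2 * M))"
  have S: "cmod (w - w0) < 1 / (2 * M)" if "w \<in> S" for w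
    using that by (simp add: S_def dist_norm norm_minus_commute)
  have "\<exists>F. \<forall>w\<in>S. (\<lambda>n. ((w - w0) ^ Suc n / of_nat (Suc n)) *\<^sub>C a n) sums F w \<and>
      (F has_derivative (\<lambda>h. h *\<^sub>C (\<Sum>n. (w - w0) ^ n *\<^sub>C a n))) (at w within S)"
  proof (rule has_derivative_series)
    show "convex S" "w0 \<in> S"
      using M by (auto simp: S_def)
    show "(\<lambda>n. ((w0 - w0) ^ Suc n / of_nat (Suc n)) *\<^sub>C a n) sums 0"
      by (simp add: scaleC.zero_left)
    have "((\<lambda>w. (w - w0) ^ Suc n / of_nat (Suc n)) has_field_derivative (w - w0) ^ n) (at w within S)"
      for n w
      by (rule derivative_eq_intros refl | simp add: field_simps del: of_nat_Suc)+
    then show "((\<lambda>w. ((w - w0) ^ Suc n / of_nat (Suc n)) *\<^sub>C a n) has_derivative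
        (\<lambda>h. ((w - w0) ^ n * h) *\<^sub>C a n)) (at w within S)" for n w
      unfolding has_field_derivative_def
      by (rule bounded_linear.has_derivative[OF scaleC.bounded_linear_left])
    fix e :: real
    assume "e > 0"
    have "uniform_limit S (\<lambda>n w. \<Sum>i<n. (w - w0) ^ i *\<^sub>C a i)
        (\<lambda>w. \<Sum>i. (w - w0) ^ i *\<^sub>C a i) sequentially"
      by (rule Weierstrass_m_test[where M = "\<lambda>n. C * (1/2) ^ n"])
         (use power_series_majorant[of a, OF a M] S in
           \<open>auto intro: summable_mult summable_geometric\<close>)
    then have "\<forall>\<^sub>F n in sequentially. \<forall>w\<in>S.
        norm ((\<Sum>i<n. (w - w0) ^ i *\<^sub>C a i) - (\<Sum>i. (w - w0) ^ i *\<^sub>C a i)) < e"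
      using \<open>e > 0\<close> by (auto simp: uniform_limit_iff dist_norm)
    then show "\<forall>\<^sub>F n in sequentially. \<forall>w\<in>S. \<forall>h.
        norm ((\<Sum>i<n. ((w - w0) ^ i * h) *\<^sub>C a i) - h *\<^sub>C (\<Sum>n. (w - w0) ^ n *\<^sub>C a n)) \<le> e * norm h"
    proof eventually_elim
      case (elim n)
      show ?case
      proof (intro ballI allI)
        fix w h
        assume "w \<in> S"
        let ?d = "(\<Sum>i<n. (w - w0) ^ i *\<^sub>C a i) - (\<Sum>i. (w - w0) ^ i *\<^sub>C a i)"
        have "(\<Sum>i<n. ((w - w0) ^ i * h) *\<^sub>C a i) = h *\<^sub>C (\<Sum>i<n. (w - w0) ^ i *\<^sub>C a i)"
          by (simp add: scaleC.sum_right scaleC_scaleC mult.commute)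
        then have "norm ((\<Sum>i<n. ((w - w0) ^ i * h) *\<^sub>C a i) - h *\<^sub>C (\<Sum>n. (w - w0) ^ n *\<^sub>C a n))
            = norm ?d * norm h"
          by (simp add: norm_scaleC mult.commute flip: scaleC.diff_right)
        also have "\<dots> \<le> e * norm h"
          by (rule mult_right_mono) (use elim \<open>w \<in> S\<close> in \<open>auto intro: less_imp_le\<close>)
        finally show "norm ((\<Sum>i<n. ((w - w0) ^ i * h) *\<^sub>C a i) -
            h *\<^sub>C (\<Sum>n. (w - w0) ^ n *\<^sub>C a n)) \<le> e * norm h" .
      qed
    qed
  qed
  then show ?thesis
    by (metis S_def at_within_open open_ball)
qed

text \<open>The Taylor coefficients at \<open>w0\<close> of the quotient by \<open>w\<close> of the power series with coefficients \<open>c\<close>,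
obtained by comparing coefficients in \<open>(w0 + h) \<Sum> h\<^sup>n a\<^sub>n = \<Sum> h\<^sup>n c\<^sub>n\<close>.\<close>

primrec quotient_coeff :: "complex \<Rightarrow> (nat \<Rightarrow> 'a::chilbert_space) \<Rightarrow> nat \<Rightarrow> 'a" where
  "quotient_coeff w0 c 0 = (1 / w0) *\<^sub>C c 0"
| "quotient_coeff w0 c (Suc n) = (1 / w0) *\<^sub>C (c (Suc n) - quotient_coeff w0 c n)"

text \<open>As soon as \<open>M\<close> is at least \<open>2 / \<bar>w0\<bar>\<close>, the recursion halves the contribution of the preceding
coefficient, so that the growth rate \<open>M\<close> is preserved.\<close>

lemma norm_quotient_coeff_le:
  assumes c: "\<And>n. norm (c n) \<le> C * M ^ n" and M: "M \<ge> 2 / cmod w0" and "w0 \<noteq> 0"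
  shows "norm (quotient_coeff w0 c n) \<le> 2 * C / cmod w0 * M ^ n"
proof (induction n)
  case 0
  have "C \<ge> 0"
    using c[of 0] norm_ge_zero[of "c 0"] by (metis mult.right_neutral order_trans power_0)
  then have "norm (c 0) \<le> 2 * C"
    using c[of 0] by simp
  then show ?case
    by (simp add: norm_scaleC norm_divide divide_right_mono)
next
  case (Suc n)
  let ?r = "cmod w0"
  have r: "?r > 0" using \<open>w0 \<noteq> 0\<close> by simp
  have "C \<ge> 0"
    using c[of 0] norm_ge_zero[of "c 0"] by (metis mult.right_neutral order_trans power_0)
  have "M > 0" using M r by (smt (verit) divide_pos_pos)
  have "2 * C / ?r * M ^ n = C * M ^ n * (2 / ?r)" by simp
  also have "\<dots> \<le> C * M ^ n * M"
    by (rule mult_left_mono[OF M]) (use \<open>C \<ge> 0\<close> \<open>M > 0\<close> in simp)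
  finally have "norm (quotient_coeff w0 c n) \<le> C * M ^ Suc n"
    using Suc by (simp add: mult_ac)
  then have "norm (c (Suc n) - quotient_coeff w0 c n) \<le> 2 * C * M ^ Suc n"
    using c[of "Suc n"] norm_triangle_ineq4[of "c (Suc n)" "quotient_coeff w0 c n"] by linarith
  then show ?case
    using r by (simp add: norm_scaleC norm_divide divide_right_mono)
qed

lemma quotient_coeff_series:
  assumes c: "\<And>n. norm (c n) \<le> C * M ^ n" and M: "M \<ge> 2 / cmod w0" and "w0 \<noteq> 0"
    and h: "cmod h < 1 / (2 * M)"
  shows "(w0 + h) *\<^sub>C (\<Sum>n. h ^ n *\<^sub>C quotient_coeff w0 c n) = (\<Sum>n. h ^ n *\<^sub>C c n)"
proof -
  let ?a = "quotient_coeff w0 c"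
  let ?C = "2 * C / cmod w0"
  have "M > 0" using M \<open>w0 \<noteq> 0\<close> by (smt (verit) divide_pos_pos zero_less_norm_iff)
  have a: "norm (?a n) \<le> ?C * M ^ n" for n
    by (rule norm_quotient_coeff_le[OF c M \<open>w0 \<noteq> 0\<close>])
  have a1: "norm (?a (Suc n)) \<le> (?C * M) * M ^ n" for n
    using a[of "Suc n"] by (simp add: mult_ac)
  have sm: "summable (\<lambda>n. h ^ n *\<^sub>C ?a n)" "summable (\<lambda>n. h ^ n *\<^sub>C ?a (Suc n))"
    by (rule power_series_summable[of _ _ M h, OF _ \<open>M > 0\<close> h]; rule a a1)+
  have c0: "c 0 = w0 *\<^sub>C ?a 0"
    using \<open>w0 \<noteq> 0\<close> by (simp add: scaleC_scaleC scaleC_one)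
  have c1: "c (Suc n) = w0 *\<^sub>C ?a (Suc n) + ?a n" for n
    using \<open>w0 \<noteq> 0\<close> by (simp add: scaleC_scaleC scaleC_one)
  have "(\<Sum>n. h ^ n *\<^sub>C c (Suc n)) = (\<Sum>n. w0 *\<^sub>C (h ^ n *\<^sub>C ?a (Suc n)) + h ^ n *\<^sub>C ?a n)"
    unfolding c1 by (simp only: scaleC_add_right scaleC_scaleC mult.commute)
  also have "\<dots> = w0 *\<^sub>C (\<Sum>n. h ^ n *\<^sub>C ?a (Suc n)) + (\<Sum>n. h ^ n *\<^sub>C ?a n)"
    using sm bounded_linear.summable[OF scaleC.bounded_linear_right sm(2)]
    by (simp add: suminf_add[symmetric] bounded_linear.suminf[OF scaleC.bounded_linear_right]
        del: quotient_coeff.simps)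
  finally have "(\<Sum>n. h ^ n *\<^sub>C c n) = w0 *\<^sub>C ?a 0 +
      h *\<^sub>C (w0 *\<^sub>C (\<Sum>n. h ^ n *\<^sub>C ?a (Suc n)) + (\<Sum>n. h ^ n *\<^sub>C ?a n))"
    using power_series_split_head[of c, OF c \<open>M > 0\<close> h] c0 by metis
  also have "\<dots> = w0 *\<^sub>C (?a 0 + h *\<^sub>C (\<Sum>n. h ^ n *\<^sub>C ?a (Suc n))) + h *\<^sub>C (\<Sum>n. h ^ n *\<^sub>C ?a n)"
    by (simp add: scaleC_algebra mult.commute del: quotient_coeff.simps)
  also have "?a 0 + h *\<^sub>C (\<Sum>n. h ^ n *\<^sub>C ?a (Suc n)) = (\<Sum>n. h ^ n *\<^sub>C ?a n)"
    by (rule power_series_split_head[of ?a, OF a \<open>M > 0\<close> h, symmetric])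
  finally show ?thesis
    by (simp add: scaleC_add_left)
qed

section \<open>The reduced inverse at an isolated spectral point\<close>

text \<open>The resolvent set is defined through \<open>B - w\<close> and the Riesz projector through \<open>w - B\<close>; this lemma
transfers the information from the one to the other.\<close>

lemma resolvent_set_inverse:
  fixes B :: "'a::chilbert_space \<Rightarrow> 'a"
  assumes B: "bounded_clinear B" and w: "w \<in> resolvent_set UNIV UNIV B"
  defines "R \<equiv> inv (\<lambda>y. w *\<^sub>C y - B y)"
  shows "bounded_linear R" "w *\<^sub>C R x - B (R x) = x" "R (w *\<^sub>C x - B x) = x"
    "R (B x) = B (R x)" "R (c *\<^sub>C x) = c *\<^sub>C R x"
proof -
  let ?T = "\<lambda>y. w *\<^sub>C y - B y"
  let ?T' = "\<lambda>y. B y - w *\<^sub>C y"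
  have bij': "bij ?T'" and inv': "bounded_clinear (inv ?T')"
    using w by (auto simp: resolvent_set_def boundedly_invertible_def)
  have "?T = uminus \<circ> ?T'"
    by auto
  then have bij: "bij ?T"
    using bij_comp[OF bij' bij_uminus] by simp
  have TR: "?T (R x) = x" and RT: "R (?T x) = x" for x
    using surj_f_inv_f[OF bij_is_surj[OF bij], of x] inv_f_f[OF bij_is_inj[OF bij], of x]
    by (simp_all add: R_def)
  show "?T (R x) = x" "R (?T x) = x" by (rule TR RT)+
  have "R = (\<lambda>x. - inv ?T' x)"
  proof
    fix x
    have "?T (- inv ?T' x) = x"
      using bij' linear_neg[OF bounded_linear.linear[OF bounded_clinear_imp_bounded_linear[OF B]]]
      by (simp add: scaleC.minus_right bij_is_surj surj_f_inv_f[of ?T'] flip: minus_diff_eq[of "B _"])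
    then show "R x = - inv ?T' x"
      by (metis RT)
  qed
  then show "bounded_linear R"
    using bounded_linear_minus[OF bounded_clinear_imp_bounded_linear[OF inv']] by simp
  have "?T (B (R x)) = B (?T (R x))"
    using B linear_diff[OF bounded_linear.linear[OF bounded_clinear_imp_bounded_linear[OF B]]]
    by (simp add: bounded_clinear_on_def clinear_on_def)
  then have "?T (B (R x)) = B x" by (simp only: TR)
  then show "R (B x) = B (R x)"
    by (metis RT)
  have "?T (c *\<^sub>C R x) = c *\<^sub>C ?T (R x)"
    using B by (simp add: bounded_clinear_on_def clinear_on_def scaleC.diff_right scaleC_scaleC
        mult.commute)
  then have "?T (c *\<^sub>C R x) = c *\<^sub>C x" by (simp only: TR)
  then show "R (c *\<^sub>C x) = c *\<^sub>C R x"
    by (metis RT)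
qed

text \<open>The Neumann series \<open>\<Sum> (- h)\<^sup>n R\<^sup>n\<^sup>+\<^sup>1 x\<close> for the resolvent at \<open>w0 + h\<close>, where \<open>R\<close> is the resolvent at
\<open>w0\<close>. The sum \<open>G\<close> satisfies \<open>G = R (x - h G)\<close>, which says \<open>(w0 + h - B) G = x\<close>; and \<open>w0 + h - B\<close>
is injective because \<open>h R\<close> is a strict contraction.\<close>

lemma resolvent_power_series:
  fixes B :: "'a::chilbert_space \<Rightarrow> 'a"
  assumes B: "bounded_clinear B" and w0: "w0 \<in> resolvent_set UNIV UNIV B"
  obtains M c where "M > 0" "\<And>x n. norm (c x n) \<le> M * norm x * M ^ n"
    "\<And>x h. cmod h < 1 / (2 * M) \<Longrightarrow>
      inv (\<lambda>y. (w0 + h) *\<^sub>C y - B y) x = (\<Sum>n. h ^ n *\<^sub>C c x n)"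
proof -
  define R where "R = inv (\<lambda>y. w0 *\<^sub>C y - B y)"
  note R = resolvent_set_inverse[OF B w0, folded R_def]
  note RC = R(5)
  interpret R: bounded_linear R by (rule R)
  interpret B: bounded_linear B by (rule bounded_clinear_imp_bounded_linear[OF B])
  obtain M where M: "M > 0" "\<And>x. norm (R x) \<le> M * norm x"
    using bounded_linear_norm_le_pos[OF R(1)] by metis
  define c where "c x n = ((\<lambda>y. - R y) ^^ n) (R x)" for x n
  have c: "norm (c x n) \<le> M * norm x * M ^ n" for x n
  proof (induction n)
    case 0
    show ?case using M by (simp add: c_def)
  next
    case (Suc n)
    have "norm (c x (Suc n)) \<le> M * norm (c x n)"
      using M(2)[of "c x n"] by (simp add: c_def)
    also have "\<dots> \<le> M * (M * norm x * M ^ n)"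
      by (rule mult_left_mono[OF Suc]) (use M in simp)
    finally show ?case by (simp add: mult_ac)
  qed
  have "inv (\<lambda>y. (w0 + h) *\<^sub>C y - B y) x = (\<Sum>n. h ^ n *\<^sub>C c x n)"
    if h: "cmod h < 1 / (2 * M)" for x h
  proof -
    define G where "G = (\<Sum>n. h ^ n *\<^sub>C c x n)"
    have sm: "summable (\<lambda>n. h ^ n *\<^sub>C c x n)"
      by (rule power_series_summable[OF c M(1) h])
    have "(\<Sum>n. h ^ n *\<^sub>C c x (Suc n)) = (\<Sum>n. - R (h ^ n *\<^sub>C c x n))"
      by (simp add: c_def RC scaleC.minus_right)
    also have "\<dots> = - R G"
      using R.summable[OF sm] by (simp add: suminf_minus G_def R.suminf[OF sm])
    finally have "(\<Sum>n. h ^ n *\<^sub>C c x (Suc n)) = - R G" .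
    moreover have "G = c x 0 + h *\<^sub>C (\<Sum>n. h ^ n *\<^sub>C c x (Suc n))"
      unfolding G_def by (rule power_series_split_head[OF c M(1) h])
    moreover have "c x 0 = R x"
      by (simp add: c_def)
    ultimately have "G = R x - h *\<^sub>C R G"
      by (metis scaleC.minus_right add_uminus_conv_diff)
    then have G: "G = R (x - h *\<^sub>C G)"
      by (simp add: R.diff RC)
    have "w0 *\<^sub>C G - B G = x - h *\<^sub>C G"
      using R(2)[of "x - h *\<^sub>C G"] G by simp
    then have TG: "(w0 + h) *\<^sub>C G - B G = x"
      by (simp add: scaleC_add_left algebra_simps)
    have inj: "inj (\<lambda>y. (w0 + h) *\<^sub>C y - B y)"
    proof (rule injI)
      fix y1 y2
      assume eq: "(w0 + h) *\<^sub>C y1 - B y1 = (w0 + h) *\<^sub>C y2 - B y2"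
      define y where "y = y1 - y2"
      have "w0 *\<^sub>C y - B y = - (h *\<^sub>C y)"
        using eq by (simp add: y_def B.diff scaleC_add_left scaleC.diff_right algebra_simps)
      then have "y = - (h *\<^sub>C R y)"
        using R(3)[of y] by (simp add: R.neg RC)
      then have "norm y = cmod h * norm (R y)"
        by (metis norm_minus_cancel norm_scaleC)
      also have "\<dots> \<le> cmod h * (M * norm y)"
        by (rule mult_left_mono[OF M(2)]) simp
      also have "\<dots> = cmod h * M * norm y"
        by simp
      finally have "norm y * (1 - cmod h * M) \<le> 0"
        by (simp add: algebra_simps)
      moreover have "cmod h * M < 1"
        using h M(1) by (simp add: field_simps)
      ultimately have "norm y \<le> 0"
        by (simp add: mult_le_0_iff)
      then show "y1 = y2"
        by (simp add: y_def)
    qed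
    show ?thesis
      using inv_f_f[OF inj, of G] TG by (simp add: G_def)
  qed
  then show thesis
    using that[of M c] M(1) c by blast
qed

text \<open>The integrand of the reduced inverse of \<open>B\<close>. The radius \<open>r\<close> and the bound \<open>K\<close> depend on \<open>w0\<close> only
and serve all vectors \<open>x\<close>, which is what makes the integral bounded in \<open>x\<close>.\<close>

lemma divided_resolvent_local_primitive:
  fixes B :: "'a::chilbert_space \<Rightarrow> 'a"
  assumes B: "bounded_clinear B" and w0: "w0 \<in> resolvent_set UNIV UNIV B" and "w0 \<noteq> 0"
  defines "f \<equiv> \<lambda>x w. (1 / w) *\<^sub>C inv (\<lambda>y. w *\<^sub>C y - B y) x"
  shows "\<exists>r>0. \<exists>K. \<forall>x. \<exists>F. \<forall>w\<in>ball w0 r.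
    (F has_derivative (\<lambda>h. h *\<^sub>C f x w)) (at w) \<and> norm (f x w) \<le> K * norm x"
proof -
  obtain M c where M: "M > 0" and c: "\<And>x n. norm (c x n) \<le> M * norm x * M ^ n"
    and R: "\<And>x h. cmod h < 1 / (2 * M) \<Longrightarrow>
      inv (\<lambda>y. (w0 + h) *\<^sub>C y - B y) x = (\<Sum>n. h ^ n *\<^sub>C c x n)"
    by (rule resolvent_power_series[OF B w0]) blast
  define N where "N = max M (2 / cmod w0)"
  have N: "N \<ge> 2 / cmod w0" "N \<ge> M" "N > 0"
    using M by (auto simp: N_def)
  have c': "norm (c x n) \<le> M * norm x * N ^ n" for x n
  proof -
    have "M * norm x * M ^ n \<le> M * norm x * N ^ n"
      using N M by (intro mult_left_mono power_mono) auto
    with c[of x n] show ?thesis by linarith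
  qed
  define a where "a x = quotient_coeff w0 (c x)" for x
  define K where "K = 4 * M / cmod w0"
  have a: "norm (a x n) \<le> 2 * (M * norm x) / cmod w0 * N ^ n" for x n
    unfolding a_def by (rule norm_quotient_coeff_le[OF c' N(1) \<open>w0 \<noteq> 0\<close>])
  let ?r = "1 / (2 * N)"
  have f: "f x w = (\<Sum>n. (w - w0) ^ n *\<^sub>C a x n)" "norm (f x w) \<le> K * norm x"
    if w: "w \<in> ball w0 ?r" for x w
  proof -
    define h where "h = w - w0"
    have h: "cmod h < ?r"
      using w by (simp add: h_def dist_norm norm_minus_commute)
    have r_le: "?r \<le> cmod w0 / 4"
      using N \<open>w0 \<noteq> 0\<close> by (simp add: field_simps)
    have "w0 + h \<noteq> 0"
    proof
      assume "w0 + h = 0"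
      then have "cmod h = cmod w0"
        by (metis add_eq_0_iff norm_minus_cancel)
      moreover have "cmod w0 > 0"
        using \<open>w0 \<noteq> 0\<close> by simp
      ultimately show False
        using h r_le by linarith
    qed
    have "cmod h < 1 / (2 * M)"
      using frac_le[of 1 1 "2 * M" "2 * N"] h N M by simp
    then have "f x w = (1 / (w0 + h)) *\<^sub>C (\<Sum>n. h ^ n *\<^sub>C c x n)"
      using R[of h x] by (simp add: f_def h_def)
    also have "\<dots> = (1 / (w0 + h)) *\<^sub>C (w0 + h) *\<^sub>C (\<Sum>n. h ^ n *\<^sub>C a x n)"
      unfolding a_def by (subst quotient_coeff_series[OF c' N(1) \<open>w0 \<noteq> 0\<close> h]) simp
    also have "\<dots> = (\<Sum>n. h ^ n *\<^sub>C a x n)"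
      using \<open>w0 + h \<noteq> 0\<close> by (simp add: scaleC_scaleC scaleC_one)
    finally show f: "f x w = (\<Sum>n. (w - w0) ^ n *\<^sub>C a x n)"
      by (simp add: h_def)
    show "norm (f x w) \<le> K * norm x"
      using power_series_norm_le[of "a x", OF a N(3) h] unfolding f h_def[symmetric] K_def by simp
  qed
  have "\<exists>F. \<forall>w\<in>ball w0 ?r.
      (F has_derivative (\<lambda>h. h *\<^sub>C f x w)) (at w) \<and> norm (f x w) \<le> K * norm x" for x
    using power_series_has_primitive[of "a x", OF a N(3), of w0] f by metis
  then show ?thesis
    using N(3) by (intro exI[of _ ?r]) auto
qed

text \<open>A valid path has a continuous derivative outside a finite set, but that derivative may be unbounded
near the exceptional points and need not be absolutely integrable. Integrability is therefore
derived from local primitives: near each parameter the fundamental theorem of calculus applies to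
the composition of the path with a primitive, which also bounds the integral by the oscillation of
the primitive; a bisection argument glues the pieces.\<close>

lemma contour_integral_vec_bounded:
  fixes f :: "'a::chilbert_space \<Rightarrow> complex \<Rightarrow> 'b::chilbert_space"
  assumes \<Gamma>: "valid_path \<Gamma>"
    and prim: "\<And>w0. w0 \<in> path_image \<Gamma> \<Longrightarrow> \<exists>r>0. \<exists>K. \<forall>x. \<exists>F. \<forall>w\<in>ball w0 r.
      (F has_derivative (\<lambda>h. h *\<^sub>C f x w)) (at w) \<and> norm (f x w) \<le> K * norm x"
  defines "g \<equiv> \<lambda>x t. vector_derivative \<Gamma> (at t within {0..1}) *\<^sub>C f x (\<Gamma> t)"
  shows "\<exists>K. \<forall>x. g x integrable_on {0..1} \<and> norm (integral {0..1} (g x)) \<le> K * norm x"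
proof -
  obtain S where contin: "continuous_on {0..1} \<Gamma>" and S: "finite S" "\<Gamma> C1_differentiable_on {0..1} - S"
    using \<Gamma> by (auto simp: valid_path_def piecewise_C1_differentiable_on_def)
  define good where "good a b \<longleftrightarrow> (0 \<le> a \<longrightarrow> a \<le> b \<longrightarrow> b \<le> 1 \<longrightarrow>
    (\<exists>K. \<forall>x. g x integrable_on {a..b} \<and> norm (integral {a..b} (g x)) \<le> K * norm x))" for a b :: real
  have "good 0 1"
  proof (rule Bolzano)
    fix a b c :: real
    assume good: "good a b" "good b c" and le: "a \<le> b" "b \<le> c"
    show "good a c"
      unfolding good_def
    proof (intro impI)
      assume ac: "0 \<le> a" "a \<le> c" "c \<le> 1"
      obtain K1 where K1: "\<And>x. g x integrable_on {a..b} \<and> norm (integral {a..b} (g x)) \<le> K1 * norm x"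
        using good(1) le ac unfolding good_def by force
      obtain K2 where K2: "\<And>x. g x integrable_on {b..c} \<and> norm (integral {b..c} (g x)) \<le> K2 * norm x"
        using good(2) le ac unfolding good_def by force
      have int: "g x integrable_on {a..c}" for x
        using Henstock_Kurzweil_Integration.integrable_combine[OF le] K1 K2 by blast
      have "norm (integral {a..c} (g x)) \<le> (K1 + K2) * norm x" for x
        using Henstock_Kurzweil_Integration.integral_combine[OF le int[of x]] K1[of x] K2[of x]
          norm_triangle_ineq[of "integral {a..b} (g x)" "integral {b..c} (g x)"]
        by (simp add: distrib_right)
      with int show "\<exists>K. \<forall>x. g x integrable_on {a..c} \<and> norm (integral {a..c} (g x)) \<le> K * norm x"
        by blast
    qed
  next
    fix s :: real
    assume "0 \<le> s" "s \<le> 1"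
    then have "\<Gamma> s \<in> path_image \<Gamma>"
      by (auto simp: path_image_def)
    then obtain r K where r: "r > 0" and K: "\<And>x. \<exists>F. \<forall>w\<in>ball (\<Gamma> s) r.
        (F has_derivative (\<lambda>h. h *\<^sub>C f x w)) (at w) \<and> norm (f x w) \<le> K * norm x"
      using prim by metis
    obtain d where d: "d > 0" and \<Gamma>d: "\<And>t. t \<in> {0..1} \<Longrightarrow> dist t s < d \<Longrightarrow> dist (\<Gamma> t) (\<Gamma> s) < r"
      using contin r \<open>0 \<le> s\<close> \<open>s \<le> 1\<close> unfolding continuous_on_iff by (metis atLeastAtMost_iff)
    (* On a short parameter interval the path stays in a disc that carries a primitive. *)
    have "good a b" if ab: "a \<le> s" "s \<le> b" "b - a < d" for a b
      unfolding good_def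
    proof (intro impI)
      assume ab': "0 \<le> a" "a \<le> b" "b \<le> 1"
      have ball: "\<Gamma> t \<in> ball (\<Gamma> s) r" if "t \<in> {a..b}" for t
        using \<Gamma>d[of t] that ab ab' by (auto simp: dist_norm norm_minus_commute)
      have "g x integrable_on {a..b} \<and> norm (integral {a..b} (g x)) \<le> 2 * r * K * norm x" for x
      proof -
        obtain F where F: "\<And>w. w \<in> ball (\<Gamma> s) r \<Longrightarrow> (F has_derivative (\<lambda>h. h *\<^sub>C f x w)) (at w)"
          and le: "\<And>w. w \<in> ball (\<Gamma> s) r \<Longrightarrow> norm (f x w) \<le> K * norm x"
          using K[of x] by blast
        have "(g x has_integral ((F \<circ> \<Gamma>) b - (F \<circ> \<Gamma>) a)) {a..b}"
        proof (rule fundamental_theorem_of_calculus_interior_strong[OF S(1) ab'(2)])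
          show "continuous_on {a..b} (F \<circ> \<Gamma>)"
          proof (rule continuous_on_compose)
            show "continuous_on {a..b} \<Gamma>"
              by (rule continuous_on_subset[OF contin]) (use ab' in auto)
            have "continuous_on (ball (\<Gamma> s) r) F"
              using F by (meson continuous_at_imp_continuous_on has_derivative_continuous)
            then show "continuous_on (\<Gamma> ` {a..b}) F"
              by (rule continuous_on_subset) (use ball in auto)
          qed
        next
          fix t
          assume t: "t \<in> {a<..<b} - S"
          then have "\<Gamma> differentiable (at t)"
            using S(2) ab' by (auto simp: C1_differentiable_on_eq)
          moreover have "at t within {0..1} = at t"
            using t ab' by (intro at_within_interior) auto
          ultimately have "(\<Gamma> has_vector_derivative vector_derivative \<Gamma> (at t within {0..1})) (at t)"
            by (simp add: vector_derivative_works)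
          moreover have "(F has_derivative (\<lambda>h. h *\<^sub>C f x (\<Gamma> t))) (at (\<Gamma> t))"
            using t ball by (intro F) auto
          ultimately have "((F \<circ> \<Gamma>) has_derivative ((\<lambda>h. h *\<^sub>C f x (\<Gamma> t)) \<circ>
              (\<lambda>h. h *\<^sub>R vector_derivative \<Gamma> (at t within {0..1})))) (at t)"
            unfolding has_vector_derivative_def by (rule diff_chain_at)
          then show "((F \<circ> \<Gamma>) has_vector_derivative g x t) (at t)"
            by (simp add: has_vector_derivative_def g_def o_def scaleC.scaleR_left)
        qed
        moreover have "norm ((F \<circ> \<Gamma>) b - (F \<circ> \<Gamma>) a) \<le> 2 * r * K * norm x"
        proof -
          have "norm (F (\<Gamma> b) - F (\<Gamma> a)) \<le> (K * norm x) * norm (\<Gamma> b - \<Gamma> a)"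
          proof (rule differentiable_bound[of "ball (\<Gamma> s) r"])
            show "(F has_derivative (\<lambda>h. h *\<^sub>C f x w)) (at w within ball (\<Gamma> s) r)"
              if "w \<in> ball (\<Gamma> s) r" for w
              using F[OF that] by (rule has_derivative_at_withinI)
            show "onorm (\<lambda>h. h *\<^sub>C f x w) \<le> K * norm x" if "w \<in> ball (\<Gamma> s) r" for w
            proof (rule onorm_bound)
              show "0 \<le> K * norm x"
                using le[OF that] norm_ge_zero[of "f x w"] by linarith
              show "norm (h *\<^sub>C f x w) \<le> K * norm x * norm h" for h
                using mult_right_mono[OF le[OF that] norm_ge_zero[of h]]
                by (simp add: norm_scaleC mult.commute)
            qed
          qed (use ball[of a] ball[of b] ab' in auto)
          also have "\<dots> \<le> (K * norm x) * (2 * r)"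
          proof (rule mult_left_mono)
            show "norm (\<Gamma> b - \<Gamma> a) \<le> 2 * r"
              using ball[of a] ball[of b] ab' dist_triangle2[of "\<Gamma> b" "\<Gamma> a" "\<Gamma> s"]
              by (auto simp: dist_norm norm_minus_commute)
            show "0 \<le> K * norm x"
              using le[of "\<Gamma> s"] r norm_ge_zero[of "f x (\<Gamma> s)"] by (metis centre_in_ball order_trans)
          qed
          finally show ?thesis by (simp add: mult_ac)
        qed
        ultimately show ?thesis
          by (metis has_integral_integrable_integral)
      qed
      then show "\<exists>K. \<forall>x. g x integrable_on {a..b} \<and> norm (integral {a..b} (g x)) \<le> K * norm x"
        by blast
    qed
    with d show "\<exists>d>0. \<forall>a b. a \<le> s \<and> s \<le> b \<and> b - a < d \<longrightarrow> good a b"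
      by blast
  qed simp
  then show ?thesis
    by (simp add: good_def)
qed

text \<open>The operator \<open>S\<close> is the reduced resolvent of \<open>B\<close> at \<open>0\<close>, written as the contour integral of
\<open>- w\<^sup>-\<^sup>1 (w - B)\<^sup>-\<^sup>1 / 2\<pi>\<i>\<close>. Applying the integrand to \<open>B x\<close> leaves \<open>- ((w - B)\<^sup>-\<^sup>1 x - w\<^sup>-\<^sup>1 x) / 2\<pi>\<i>\<close>: the first
term integrates to \<open>- P x\<close>, and the second to \<open>x\<close>, because the winding number at \<open>0\<close> is \<open>1\<close>.\<close>

lemma riesz_projector_reduced_inverse:
  fixes B :: "'h::chilbert_space \<Rightarrow> 'h"
  assumes B: "bounded_clinear B" and \<Gamma>: "riesz_contour B 0 \<Gamma>" and 0: "0 \<in> spectrum B"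
  obtains S where "bounded_clinear S"
    "\<And>x. S (B x) = x - riesz_projector B \<Gamma> x" "\<And>x. B (S x) = x - riesz_projector B \<Gamma> x"
proof -
  define R where "R w = inv (\<lambda>y. w *\<^sub>C y - B y)" for w
  define \<gamma>' where "\<gamma>' t = vector_derivative \<Gamma> (at t within {0..1})" for t
  define g where "g x t = \<gamma>' t *\<^sub>C ((1 / \<Gamma> t) *\<^sub>C R (\<Gamma> t) x)" for x t
  define k where "k = - 1 / (2 * of_real pi * \<i>)"
  define S where "S x = k *\<^sub>C integral {0..1} (g x)" for x
  have res: "w \<in> resolvent_set UNIV UNIV B" if "w \<in> path_image \<Gamma>" for w
    using \<Gamma> that by (auto simp: riesz_contour_def)
  have vp: "valid_path \<Gamma>" and wn: "winding_number \<Gamma> 0 = 1"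
    using \<Gamma> by (auto simp: riesz_contour_def)
  (* Division by the path parameter is legitimate because 0 lies in the spectrum. *)
  have notin: "0 \<notin> path_image \<Gamma>"
    using 0 res by (auto simp: spectrum_def)
  have res': "\<Gamma> t \<in> resolvent_set UNIV UNIV B" "\<Gamma> t \<noteq> 0" if "t \<in> {0..1}" for t
    using res notin that by (force simp: path_image_def)+
  have BC: "B (c *\<^sub>C x) = c *\<^sub>C B x" for c x
    using B by (simp add: bounded_clinear_on_def clinear_on_def)
  interpret B: bounded_linear B
    by (rule bounded_clinear_imp_bounded_linear[OF B])
  have RC: "R (\<Gamma> t) (c *\<^sub>C x) = c *\<^sub>C R (\<Gamma> t) x" if "t \<in> {0..1}" for t c x
    unfolding R_def by (rule resolvent_set_inverse(5)[OF B res'(1)[OF that]])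
  have "\<exists>K. \<forall>x. g x integrable_on {0..1} \<and> norm (integral {0..1} (g x)) \<le> K * norm x"
    unfolding g_def \<gamma>'_def
  proof (rule contour_integral_vec_bounded[OF vp])
    fix w0
    assume "w0 \<in> path_image \<Gamma>"
    with notin res show "\<exists>r>0. \<exists>K. \<forall>x. \<exists>F. \<forall>w\<in>ball w0 r.
        (F has_derivative (\<lambda>h. h *\<^sub>C (1 / w) *\<^sub>C R w x)) (at w) \<and>
        norm ((1 / w) *\<^sub>C R w x) \<le> K * norm x"
      unfolding R_def by (intro divided_resolvent_local_primitive[OF B]) auto
  qed
  then obtain K where int: "\<And>x. g x integrable_on {0..1}"
    and K: "\<And>x. norm (integral {0..1} (g x)) \<le> K * norm x"
    by blast
  have "bounded_linear (\<lambda>x. integral {0..1} (g x))"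
  proof (rule bounded_linear_intro[of _ K])
    fix x y
    have "integral {0..1} (g (x + y)) = integral {0..1} (\<lambda>t. g x t + g y t)"
      by (rule integral_cong)
        (auto simp: g_def R_def scaleC_add_right
          linear_add[OF bounded_linear.linear[OF resolvent_set_inverse(1)[OF B res'(1)]]])
    then show "integral {0..1} (g (x + y)) = integral {0..1} (g x) + integral {0..1} (g y)"
      by (simp add: integral_add int)
  next
    fix r x
    have "integral {0..1} (g (r *\<^sub>R x)) = integral {0..1} (\<lambda>t. r *\<^sub>R g x t)"
      by (rule integral_cong)
        (auto simp: g_def R_def scaleC.scaleR_right
          linear_scale[OF bounded_linear.linear[OF resolvent_set_inverse(1)[OF B res'(1)]]])
    then show "integral {0..1} (g (r *\<^sub>R x)) = r *\<^sub>R integral {0..1} (g x)"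
      by simp
  qed (use K in \<open>simp add: mult.commute\<close>)
  then have "bounded_linear S"
    unfolding S_def by (rule bounded_linear_compose[OF scaleC.bounded_linear_right])
  moreover have "S (c *\<^sub>C x) = c *\<^sub>C S x" for c x
  proof -
    have "integral {0..1} (g (c *\<^sub>C x)) = integral {0..1} (\<lambda>t. c *\<^sub>C g x t)"
      by (rule integral_cong) (auto simp: g_def RC res' scaleC_scaleC mult_ac)
    also have "\<dots> = c *\<^sub>C integral {0..1} (g x)"
      using integral_linear[OF int scaleC.bounded_linear_right[of c]] by (simp add: o_def)
    finally show ?thesis
      by (simp add: S_def scaleC_scaleC mult.commute)
  qed
  ultimately have "bounded_clinear S"
    by (rule bounded_clinearI)
  moreover have SB: "S (B x) = x - riesz_projector B \<Gamma> x" for x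
  proof -
    have "((\<lambda>w. 1 / (w - 0)) has_contour_integral (2 * pi * \<i> * winding_number \<Gamma> 0)) \<Gamma>"
      by (rule has_contour_integral_winding_number[OF vp notin])
    then have "((\<lambda>t. (1 / \<Gamma> t) * \<gamma>' t) has_integral (2 * pi * \<i>)) {0..1}"
      by (simp add: has_contour_integral_def wn \<gamma>'_def)
    then have I: "((\<lambda>t. ((1 / \<Gamma> t) * \<gamma>' t) *\<^sub>C x) has_integral ((2 * pi * \<i>) *\<^sub>C x)) {0..1}"
      using has_integral_linear[OF _ scaleC.bounded_linear_left[of x]] by (force simp: o_def)
    have "\<gamma>' t *\<^sub>C R (\<Gamma> t) x = ((1 / \<Gamma> t) * \<gamma>' t) *\<^sub>C x + g (B x) t" if t: "t \<in> {0..1}" for t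
    proof -
      note R = resolvent_set_inverse[OF B res'(1)[OF t], folded R_def]
      have "R (\<Gamma> t) x = (1 / \<Gamma> t) *\<^sub>C (x + R (\<Gamma> t) (B x))"
        using R(2)[of x] R(4)[of x] res'(2)[OF t]
        by (metis diff_add_cancel mult.commute nonzero_eq_divide_eq scaleC_one scaleC_scaleC)
      then show ?thesis
        by (metis g_def mult.commute scaleC_add_right scaleC_scaleC)
    qed
    then have "contour_integral_vec \<Gamma> (\<lambda>w. R w x)
        = integral {0..1} (\<lambda>t. ((1 / \<Gamma> t) * \<gamma>' t) *\<^sub>C x + g (B x) t)"
      unfolding contour_integral_vec_def \<gamma>'_def by (intro integral_cong) auto
    also have "\<dots> = (2 * pi * \<i>) *\<^sub>C x + integral {0..1} (g (B x))"
      by (rule integral_unique[OF has_integral_add[OF I integrable_integral[OF int]]])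
    finally have "riesz_projector B \<Gamma> x = (- k) *\<^sub>C ((2 * pi * \<i>) *\<^sub>C x) - S (B x)"
      by (simp add: riesz_projector_def R_def k_def S_def scaleC_add_right scaleC.minus_left)
    also have "(- k) *\<^sub>C ((2 * pi * \<i>) *\<^sub>C x) = x"
      by (simp add: scaleC_scaleC k_def scaleC_one)
    finally show ?thesis by simp
  qed
  moreover have "B (S x) = S (B x)" for x
  proof -
    have "B (integral {0..1} (g x)) = integral {0..1} (\<lambda>t. B (g x t))"
      using integral_linear[OF int B.bounded_linear_axioms] by (simp add: o_def)
    also have "\<dots> = integral {0..1} (g (B x))"
      by (rule integral_cong)
        (use resolvent_set_inverse(4)[OF B res'(1)] in \<open>auto simp: g_def BC R_def\<close>)
    finally show ?thesis
      by (simp add: S_def BC)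
  qed
  ultimately show thesis
    using that by metis
qed

section \<open>Strong coupling\<close>

text \<open>The block elimination behind the main result. Here \<open>R\<close> stands for \<open>(P A - z)\<^sup>-\<^sup>1 P\<close> and \<open>J\<close> for the
inverse of \<open>Q\<close> precomposed with \<open>Q = Id - P\<close>, both as operators on the whole space. The first
coordinate of the solution is \<open>u = R (y - E w)\<close> with \<open>w = Q x\<close>, and eliminating it leaves the single bounded
equation \<open>\<beta> w = G (y - E w)\<close>. Once \<open>\<beta> \<ge> 2 \<parallel>G E\<parallel>\<close> this equation is solvable by contraction and its
solution is of order \<open>\<parallel>y\<parallel> / \<beta>\<close>.\<close>

lemma strong_coupling_estimate:
  fixes A B P S R J :: "'h::chilbert_space \<Rightarrow> 'h"
  assumes P: "bounded_clinear P" and B: "bounded_clinear B" and S: "bounded_clinear S"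
    and PB: "\<And>x. P (B x) = 0"
    and SB: "\<And>x. S (B x) = x - P x" and BS: "\<And>x. B (S x) = x - P x"
    and A: "clinear_on DA A"
    and R: "bounded_clinear R" and R_dom: "\<And>x. R x \<in> DA" and PR: "\<And>x. P (R x) = R x"
    and PAR: "\<And>x. P (A (R x)) - z *\<^sub>C R x = P x"
    and R_unique: "\<And>u x. u \<in> DA \<Longrightarrow> P u = u \<Longrightarrow> P (A u) - z *\<^sub>C u = P x \<Longrightarrow> u = R x"
    and QAR: "bounded_clinear (\<lambda>x. A (R x) - P (A (R x)))"
    and J: "bounded_clinear J" and J_dom: "\<And>x. J x \<in> DA"
    and QJ: "\<And>x. J x - P (J x) = x - P x"
    and AJ: "bounded_clinear (\<lambda>x. A (J x))"
  defines "T \<equiv> \<lambda>\<beta> x. A x + \<beta> *\<^sub>R B x - z *\<^sub>C x"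
  obtains C \<beta>0 where "C > 0" "\<beta>0 > 0" "\<And>\<beta> y. \<beta> \<ge> \<beta>0 \<Longrightarrow> \<exists>x\<in>DA. T \<beta> x = y"
    "\<And>\<beta> x. \<beta> \<ge> \<beta>0 \<Longrightarrow> x \<in> DA \<Longrightarrow> norm (x - R (T \<beta> x)) \<le> C / \<beta> * norm (T \<beta> x)"
proof -
  interpret P: bounded_linear P by (rule bounded_clinear_imp_bounded_linear[OF P])
  interpret B: bounded_linear B by (rule bounded_clinear_imp_bounded_linear[OF B])
  interpret S: bounded_linear S by (rule bounded_clinear_imp_bounded_linear[OF S])
  interpret R: bounded_linear R by (rule bounded_clinear_imp_bounded_linear[OF R])
  have PC: "P (c *\<^sub>C x) = c *\<^sub>C P x" for c x
    using P by (simp add: bounded_clinear_on_def clinear_on_def)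
  have A_add: "A (x + y) = A x + A y" "x + y \<in> DA" if "x \<in> DA" "y \<in> DA" for x y
    using A that by (auto simp: clinear_on_def csubspace_def)
  note A_diff = clinear_on_diff[OF A]
  have PP: "P (P x) = P x" for x
    using PB[of "S x"] by (simp add: BS P.diff)
  have BP: "B (P x) = 0" for x
    using BS[of "B x"] SB[of x] PB[of x] by (simp add: B.diff)
  define E where "E w = A (J w) - z *\<^sub>C J w" for w
  define G where "G a = S (a - P a - (A (R a) - P (A (R a))))" for a
  have E: "bounded_clinear E"
    unfolding E_def by (intro bounded_clinear_sub AJ bounded_clinear_scaleC J)
  have id: "bounded_clinear (\<lambda>x::'h. x)"
    by (rule bounded_clinearI) (simp_all add: bounded_linear_ident)
  have G: "bounded_clinear G"
    unfolding G_def
    by (rule bounded_clinear_compose_on[OF S]) (intro bounded_clinear_sub P QAR id UNIV_I)+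
  interpret E: bounded_linear E by (rule bounded_clinear_imp_bounded_linear[OF E])
  interpret G: bounded_linear G by (rule bounded_clinear_imp_bounded_linear[OF G])
  (* B commutes with S, so S maps the range of Q into itself; hence solutions w lie in the range of Q. *)
  have PG: "P (G a) = 0" for a
  proof -
    define b where "b = S (a - A (R a))"
    have "G a = S (B b)"
      unfolding G_def b_def by (simp add: BS P.diff algebra_simps)
    also have "\<dots> = b - P b" by (rule SB)
    finally show ?thesis by (simp add: P.diff PP)
  qed
  have BG: "B (G a) = a - P a - (A (R a) - P (A (R a)))" for a
    by (simp add: G_def BS P.diff PP)
  (* Every solution of the original equation solves the reduced system. *)
  have reduce: "\<beta> *\<^sub>R (x - P x) = G (y - E (x - P x))"
      "x = J (x - P x) + R (y - E (x - P x))"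
    if x: "x \<in> DA" and y: "T \<beta> x = y" for \<beta> x y
  proof -
    define w where "w = x - P x"
    define u where "u = x - J w"
    have u: "u \<in> DA" "A u = A x - A (J w)"
      unfolding u_def using A_diff[OF x J_dom] by auto
    have "J w - P (J w) = x - P x"
      by (simp add: QJ) (simp add: w_def P.diff PP)
    then have Pu: "P u = u"
      by (simp add: u_def P.diff algebra_simps)
    have x_eq: "x = J w + u"
      by (simp add: u_def)
    have Bx: "S (\<beta> *\<^sub>R B x) = \<beta> *\<^sub>R w"
      by (simp add: S.scaleR SB w_def)
    have y_eq: "y = E w + (A u - z *\<^sub>C u) + \<beta> *\<^sub>R B x"
      unfolding y[symmetric] T_def E_def u(2) by (simp add: u_def scaleC.diff_right)
    have "P (A u) - z *\<^sub>C u = P (y - E w)"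
      by (simp add: y_eq P.add P.diff P.scaleR PB PC Pu)
    then have uR: "u = R (y - E w)"
      using R_unique u Pu by blast
    have "\<beta> *\<^sub>R B x = (y - E w) - P (y - E w) - (A u - P (A u))"
      by (simp add: y_eq P.add P.diff P.scaleR PB PC Pu)
    then have "\<beta> *\<^sub>R w = G (y - E w)"
      unfolding G_def uR[symmetric] Bx[symmetric] by simp
    with x_eq uR show "\<beta> *\<^sub>R (x - P x) = G (y - E (x - P x))"
      "x = J (x - P x) + R (y - E (x - P x))"
      by (simp_all add: w_def)
  qed
  (* Conversely, each solution of the reduced equation gives one of the original equation. *)
  have expand: "\<exists>x\<in>DA. T \<beta> x = y" if w: "\<beta> *\<^sub>R w = G (y - E w)" and "\<beta> > 0" for \<beta> w y
  proof -
    define a where "a = y - E w"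
    define u where "u = R a"
    define x where "x = J w + u"
    have u: "u \<in> DA" "P u = u" "P (A u) - z *\<^sub>C u = P a"
      by (simp_all add: u_def R_dom PR PAR)
    have Pw: "P w = 0"
      using PG[of a] \<open>\<beta> > 0\<close> by (simp add: a_def P.scaleR flip: w)
    then have "J w = w + P (J w)"
      using QJ[of w] by (simp add: algebra_simps)
    then have "x = w + P (J w + u)"
      by (simp add: x_def P.add u(2))
    then have "B x = B w"
      by (metis B.add BP add.right_neutral)
    then have "\<beta> *\<^sub>R B x = B (G a)"
      by (simp add: a_def B.scaleR flip: w)
    also have "\<dots> = a - P a - (A u - P (A u))"
      by (simp add: BG u_def)
    finally have "T \<beta> x = y"
      using u(3)
      by (simp add: T_def x_def A_add J_dom u(1) scaleC_add_right a_def E_def algebra_simps)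
    moreover have "x \<in> DA"
      by (simp add: x_def A_add J_dom u(1))
    ultimately show ?thesis by blast
  qed
  obtain KG where KG: "KG > 0" "\<And>x. norm (G x) \<le> KG * norm x"
    by (rule bounded_linear_norm_le_pos[OF G.bounded_linear_axioms]) blast
  have GE: "bounded_linear (\<lambda>w. G (E w))"
    by (rule bounded_linear_compose) (rule G.bounded_linear_axioms E.bounded_linear_axioms)+
  obtain KN where KN: "KN > 0" "\<And>x. norm (G (E x)) \<le> KN * norm x"
    by (rule bounded_linear_norm_le_pos[OF GE]) blast
  have JRE: "bounded_linear (\<lambda>w. J w - R (E w))"
    by (intro bounded_linear_sub bounded_clinear_imp_bounded_linear[OF J]
        bounded_linear_compose[OF R.bounded_linear_axioms E.bounded_linear_axioms])
  obtain KM where KM: "KM > 0" "\<And>x. norm (J x - R (E x)) \<le> KM * norm x"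
    by (rule bounded_linear_norm_le_pos[OF JRE]) blast
  show thesis
  proof (rule that[of "KM * (2 * KG)" "2 * KN"])
    show "KM * (2 * KG) > 0" using KM KG by simp
    show "2 * KN > 0" using KN by simp
  next
    fix \<beta> y
    assume "2 * KN \<le> \<beta>"
    then have "\<beta> > 0" using KN(1) by linarith
    define f where "f w = (1 / \<beta>) *\<^sub>R G (y - E w)" for w
    have "dist (f v) (f w) \<le> 1 / 2 * dist v w" for v w
    proof -
      have "f v - f w = - ((1 / \<beta>) *\<^sub>R G (E (v - w)))"
        by (simp add: f_def G.diff E.diff algebra_simps)
      then have "dist (f v) (f w) = 1 / \<beta> * norm (G (E (v - w)))"
        using \<open>\<beta> > 0\<close> by (simp add: dist_norm)
      also have "\<dots> \<le> 1 / \<beta> * (KN * norm (v - w))"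
        by (rule mult_left_mono[OF KN(2)]) (use \<open>\<beta> > 0\<close> in simp)
      also have "\<dots> = KN / \<beta> * norm (v - w)"
        by simp
      also have "\<dots> \<le> 1 / 2 * norm (v - w)"
        by (rule mult_right_mono) (use \<open>\<beta> > 0\<close> \<open>2 * KN \<le> \<beta>\<close> in \<open>simp_all add: field_simps\<close>)
      finally show ?thesis by (simp add: dist_norm)
    qed
    then obtain w where "f w = w"
      using banach_fix_type[of "1/2" f] by auto
    then have "\<beta> *\<^sub>R f w = \<beta> *\<^sub>R w"
      by simp
    then have "\<beta> *\<^sub>R w = G (y - E w)"
      using \<open>\<beta> > 0\<close> by (simp add: f_def)
    then show "\<exists>x\<in>DA. T \<beta> x = y"
      using expand \<open>\<beta> > 0\<close> by blast
  next
    fix \<beta> x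
    assume \<beta>: "2 * KN \<le> \<beta>" and x: "x \<in> DA"
    then have "\<beta> > 0" using KN(1) by linarith
    define y where "y = T \<beta> x"
    define w where "w = x - P x"
    note w = reduce[OF x y_def[symmetric], folded w_def]
    have "\<beta> * norm w = norm (G y - G (E w))"
      using \<open>\<beta> > 0\<close> arg_cong[OF w(1), of norm] by (simp add: G.diff)
    also have "\<dots> \<le> KG * norm y + KN * norm w"
      using norm_triangle_ineq4[of "G y" "G (E w)"] KG(2)[of y] KN(2)[of w] by linarith
    also have "\<dots> \<le> KG * norm y + \<beta> / 2 * norm w"
      using mult_right_mono[of "2 * KN" \<beta> "norm w"] \<beta> by simp
    finally have "norm w \<le> 2 * KG / \<beta> * norm y"
      using \<open>\<beta> > 0\<close> by (simp add: field_simps)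
    then have "KM * norm w \<le> KM * (2 * KG / \<beta> * norm y)"
      by (rule mult_left_mono) (use KM in simp)
    moreover have "x - R y = J w - R (E w)"
      using w(2) by (simp add: R.diff algebra_simps)
    then have "norm (x - R y) \<le> KM * norm w"
      using KM(2)[of w] by simp
    ultimately show "norm (x - R (T \<beta> x)) \<le> KM * (2 * KG) / \<beta> * norm (T \<beta> x)"
      by (simp add: y_def)
  qed
qed

theorem theorem3p10:
  fixes A B P Q :: "'h::chilbert_space \<Rightarrow> 'h"
    and DA D Dt :: "'h set"
    and \<Gamma> :: "real \<Rightarrow> complex"
    and z :: complex
  assumes "bounded_clinear B"
    and "isolated_eigenvalue B 0"
    and "riesz_contour B 0 \<Gamma>"
    and "P = riesz_projector B \<Gamma>"
    and "Q = (\<lambda>x. x - P x)"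
    and no_quasi_nilpotent_part: "\<forall>x. P (B x) = 0"
    and "closed_operator DA A"
    and "D = DA \<inter> range P"
    and "densely_defined_on (range P) D"
    and "closed_operator D (\<lambda>x. P (A x))"
    and "z \<in> resolvent_set DA UNIV A"
    and "z \<in> resolvent_set D (range P) (\<lambda>x. P (A x))"
    and "Dt = graph_orthogonal_complement DA A D"
    and "extends_boundedly DA (\<lambda>x. Q (A x))"
    and "extends_boundedly Dt A"
    and "boundedly_invertible (closure Dt) (range Q) Q"
  shows "(\<forall>\<^sub>F \<beta> in at_top.
        boundedly_invertible DA UNIV (\<lambda>x. A x + \<beta> *\<^sub>R B x - z *\<^sub>C x)) \<and>
    (\<exists>C. \<forall>\<^sub>F \<beta> in at_top.
        bounded_clinear (\<lambda>x. resolvent DA (\<lambda>y. A y + \<beta> *\<^sub>R B y) z x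
          - P (resolvent D (\<lambda>y. P (A y)) z (P x))) \<and>
        onorm (\<lambda>x. resolvent DA (\<lambda>y. A y + \<beta> *\<^sub>R B y) z x
          - P (resolvent D (\<lambda>y. P (A y)) z (P x))) \<le> C / \<beta>) \<and>
    ((\<lambda>\<beta>. onorm (\<lambda>x. resolvent DA (\<lambda>y. A y + \<beta> *\<^sub>R B y) z x
        - P (resolvent D (\<lambda>y. P (A y)) z (P x)))) \<longlongrightarrow> 0) at_top"
proof -
  note B = assms(1) and Q_def = assms(5) and D_def = assms(8) and A_closed = assms(7)
  have Q: "Q x = x - P x" for x
    by (simp add: Q_def)
  have "0 \<in> spectrum B"
    using assms(2) by (auto simp: isolated_eigenvalue_def isolated_in_def)
  then obtain S where S: "bounded_clinear S"
    and SB: "\<And>x. S (B x) = x - P x" and BS: "\<And>x. B (S x) = x - P x"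
    using riesz_projector_reduced_inverse[OF B assms(3)] assms(4) by metis
  have PB: "P (B x) = 0" for x
    using no_quasi_nilpotent_part by simp
  have id: "bounded_clinear (\<lambda>x::'h. x)"
    by (rule bounded_clinearI) (simp_all add: bounded_linear_ident)
  have SB': "bounded_clinear (\<lambda>x. S (B x))"
    by (rule bounded_clinear_compose_on[OF S B]) simp
  have "P = (\<lambda>x. x - S (B x))"
    by (simp add: SB)
  then have P: "bounded_clinear P"
    using bounded_clinear_sub[OF id SB'] by simp
  have Q_bounded: "bounded_clinear Q"
    unfolding Q_def by (rule bounded_clinear_sub[OF id P])
  (* Idempotence of P comes from P Q = P B S = 0. *)
  have PP: "P (P x) = P x" for x
    using PB[of "S x"] linear_diff[OF bounded_linear.linear[OF bounded_clinear_imp_bounded_linear[OF P]]]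
    by (simp add: BS)
  have A: "clinear_on DA A"
    using A_closed by (simp add: closed_operator_def)

  define V where "V = closure Dt"
  have "Dt \<subseteq> DA"
    by (auto simp: assms(13) graph_orthogonal_complement_def)
  then have V: "V \<subseteq> DA" "bounded_clinear_on V A"
    using closure_subset_closed_operator_domain[OF A_closed _ assms(15)] by (auto simp: V_def)
  have bijQ: "bij_betw Q V (range Q)" and invQ: "bounded_clinear_on (range Q) (inv_into V Q)"
    using assms(16) by (auto simp: boundedly_invertible_def V_def)
  define J where "J x = inv_into V Q (Q x)" for x
  have J: "bounded_clinear J"
    unfolding J_def by (rule bounded_clinear_compose_on[OF invQ Q_bounded]) simp
  have JV: "J x \<in> V" and QJ: "Q (J x) = Q x" for x
    using bijQ by (auto simp: J_def bij_betw_def intro: inv_into_into f_inv_into_f)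
  have AJ: "bounded_clinear (\<lambda>x. A (J x))"
    by (rule bounded_clinear_compose_on[OF V(2) J JV])

  define R0 where "R0 = resolvent D (\<lambda>y. P (A y)) z"
  have bijR: "bij_betw (\<lambda>x. P (A x) - z *\<^sub>C x) D (range P)"
    and R0: "bounded_clinear_on (range P) R0"
    using assms(12) by (auto simp: resolvent_set_def boundedly_invertible_def R0_def resolvent_def)
  define R where "R x = R0 (P x)" for x
  have R: "bounded_clinear R"
    unfolding R_def by (rule bounded_clinear_compose_on[OF R0 P]) simp
  have RD: "R x \<in> D" and PAR: "P (A (R x)) - z *\<^sub>C R x = P x" for x
    using bij_betw_imp_surj_on[OF bijR] inv_into_into[of "P x" "\<lambda>x. P (A x) - z *\<^sub>C x" D]
      f_inv_into_f[of "P x" "\<lambda>x. P (A x) - z *\<^sub>C x" D]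
    by (auto simp: R_def R0_def resolvent_def)
  (* The domain of the compression consists of the fixed points of P in DA, so its resolvent
     is characterised by an equation on DA. *)
  have R_unique: "u = R x" if "u \<in> DA" "P u = u" "P (A u) - z *\<^sub>C u = P x" for u x
  proof -
    have "u \<in> D"
      using that by (metis D_def IntI rangeI)
    then show ?thesis
      using inv_into_f_f[OF bij_betw_imp_inj_on[OF bijR], of u] that
      by (simp add: R_def R0_def resolvent_def)
  qed
  have RDA: "R x \<in> DA" and PR: "P (R x) = R x" for x
    using RD[of x] PP by (auto simp: D_def)
  have QAR: "bounded_clinear (\<lambda>x. A (R x) - P (A (R x)))"
  proof -
    obtain T where T: "\<And>x. x \<in> DA \<Longrightarrow> T x = Q (A x)" "bounded_clinear_on (closure DA) T"
      using assms(14) by (auto simp: extends_boundedly_def)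
    have "bounded_clinear (\<lambda>x. T (R x))"
      using bounded_clinear_compose_on[OF T(2) R] RDA closure_subset by blast
    then show ?thesis
      by (simp add: T(1)[OF RDA] Q)
  qed

  let ?T = "\<lambda>\<beta> x. A x + \<beta> *\<^sub>R B x - z *\<^sub>C x"
  obtain C \<beta>0 where C: "C > 0" and \<beta>0: "\<beta>0 > 0"
    and surj: "\<And>\<beta> y. \<beta> \<ge> \<beta>0 \<Longrightarrow> \<exists>x\<in>DA. ?T \<beta> x = y"
    and le: "\<And>\<beta> x. \<beta> \<ge> \<beta>0 \<Longrightarrow> x \<in> DA \<Longrightarrow> norm (x - R (?T \<beta> x)) \<le> C / \<beta> * norm (?T \<beta> x)"
    by (rule strong_coupling_estimate[OF P B S PB SB BS A R RDA PR PAR R_unique QAR J _ _ AJ])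
       (use JV V(1) QJ in \<open>auto simp: Q\<close>)
  obtain KR where KR: "\<And>x. norm (R x) \<le> KR * norm x"
    using R by (auto simp: bounded_clinear_on_def)
  define I where "I \<beta> = resolvent DA (\<lambda>y. A y + \<beta> *\<^sub>R B y) z" for \<beta>
  have inv: "boundedly_invertible DA UNIV (?T \<beta>)" if "\<beta> \<ge> \<beta>0" for \<beta>
  proof (rule boundedly_invertible_UNIV_I[OF _ surj[OF that]])
    have "B (x + y) = B x + B y" "B (c *\<^sub>C x) = c *\<^sub>C B x" for x y c
      using B by (auto simp: bounded_clinear_on_def clinear_on_def)
    then show "clinear_on DA (?T \<beta>)"
      using A
      by (auto simp: clinear_on_def scaleC_algebra scaleC.scaleR_right scaleR_add_right mult.commute)
    show "norm x \<le> (KR + C / \<beta>) * norm (?T \<beta> x)" if "x \<in> DA" for x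
      using le[OF \<open>\<beta> \<ge> \<beta>0\<close> that] KR[of "?T \<beta> x"] norm_triangle_sub[of x "R (?T \<beta> x)"]
      by (simp add: distrib_right)
  qed
  have diff: "bounded_clinear (\<lambda>x. I \<beta> x - P (R0 (P x)))"
    and norm_diff: "onorm (\<lambda>x. I \<beta> x - P (R0 (P x))) \<le> C / \<beta>" if \<beta>: "\<beta> \<ge> \<beta>0" for \<beta>
  proof -
    have bij: "bij_betw (?T \<beta>) DA UNIV" and I: "bounded_clinear (I \<beta>)"
      using inv[OF \<beta>] by (auto simp: boundedly_invertible_def I_def resolvent_def)
    have PR': "P (R0 (P x)) = R x" for x
      using PR by (simp add: R_def)
    show "bounded_clinear (\<lambda>x. I \<beta> x - P (R0 (P x)))"
      unfolding PR' by (rule bounded_clinear_sub[OF I R])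
    have "I \<beta> y \<in> DA" "?T \<beta> (I \<beta> y) = y" for y
      using bij_betw_imp_surj_on[OF bij] inv_into_into[of y "?T \<beta>" DA] f_inv_into_f[of y "?T \<beta>" DA]
      by (auto simp: I_def resolvent_def)
    then have "norm (I \<beta> y - R y) \<le> C / \<beta> * norm y" for y
      using le[OF \<beta>, of "I \<beta> y"] by simp
    then show "onorm (\<lambda>x. I \<beta> x - P (R0 (P x))) \<le> C / \<beta>"
      unfolding PR' using C \<beta> \<beta>0 by (intro onorm_bound) auto
  qed
  have lim: "((\<lambda>\<beta>. onorm (\<lambda>x. I \<beta> x - P (R0 (P x)))) \<longlongrightarrow> 0) at_top"
  proof (rule tendsto_sandwich)
    show "\<forall>\<^sub>F \<beta> in at_top. 0 \<le> onorm (\<lambda>x. I \<beta> x - P (R0 (P x)))"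
      using eventually_ge_at_top[of \<beta>0]
      by eventually_elim (intro onorm_pos_le bounded_clinear_imp_bounded_linear diff)
    show "\<forall>\<^sub>F \<beta> in at_top. onorm (\<lambda>x. I \<beta> x - P (R0 (P x))) \<le> C / \<beta>"
      using eventually_ge_at_top[of \<beta>0] by eventually_elim (rule norm_diff)
    show "((\<lambda>\<beta>. C / \<beta>) \<longlongrightarrow> 0) at_top"
      by (intro real_tendsto_divide_at_top[OF tendsto_const] filterlim_ident)
  qed simp
  show ?thesis
    unfolding I_def[symmetric] R0_def[symmetric]
  proof (intro conjI exI[of _ C])
    show "\<forall>\<^sub>F \<beta> in at_top. boundedly_invertible DA UNIV (?T \<beta>)"
      using eventually_ge_at_top[of \<beta>0] by eventually_elim (rule inv)
    show "\<forall>\<^sub>F \<beta> in at_top. bounded_clinear (\<lambda>x. I \<beta> x - P (R0 (P x))) \<and>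
        onorm (\<lambda>x. I \<beta> x - P (R0 (P x))) \<le> C / \<beta>"
      using eventually_ge_at_top[of \<beta>0] by eventually_elim (intro conjI diff norm_diff)
  qed (rule lim)
qed

end
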